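(* Let $0<q<1$, let $k\ge1$ be an integer, and let $a\neq0$, $c$, $x_1,y_1,\ldots,x_k,y_k$ be complex numbers with $\max\{|a|,|c|,|x_1|,|y_1|,\ldots,|x_k|,|y_k|\}<1$. Then $$\sum_{n_1,n_2,\ldots,n_k=0}^\infty\frac{(a;q)_{n_1+n_2+\cdots+n_k}\,h_{n_1}(x_1,y_1|q)h_{n_2}(x_2,y_2|q)\cdots h_{n_k}(x_k,y_k|q)}{(c;q)_{n_1+n_2+\cdots+n_k}(q;q)_{n_1}(q;q)_{n_2}\cdots(q;q)_{n_k}}$$ $$=\frac{(a;q)_\infty}{(c,x_1,y_1,x_2,y_2,\ldots,x_k,y_k;q)_\infty}\;{}_{2k+1}\phi_{2k}\left({c/a,x_1,y_1,x_2,y_2,\ldots,x_k,y_k\atop 0,0,\ldots,0};q,a\right).$$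
   Context: $(a;q)_0=1$, $(a;q)_n=\prod_{i=0}^{n-1}(1-aq^i)$, $(a;q)_\infty=\prod_{i=0}^\infty(1-aq^i)$, and $(a_1,\ldots,a_r;q)_n=(a_1;q)_n\cdots(a_r;q)_n$ for $n$ an integer or $\infty$. The basic hypergeometric series is ${}_r\phi_s\left({a_1,\ldots,a_r\atop b_1,\ldots,b_s};q,z\right)=\sum_{n=0}^\infty\frac{(a_1,\ldots,a_r;q)_n}{(q,b_1,\ldots,b_s;q)_n}\left((-1)^nq^{n(n-1)/2}\right)^{1+s-r}z^n$. The Rogers-Szegő polynomials are $h_n(x,y|q)=\sum_{j=0}^n{n\brack j}_q x^jy^{n-j}$ with ${n\brack j}_q=\frac{(q;q)_n}{(q;q)_j(q;q)_{n-j}}$. *)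

theory Defs
  imports "HOL-Analysis.Analysis"
begin

definition qpoch :: "complex \<Rightarrow> complex \<Rightarrow> nat \<Rightarrow> complex" where
  "qpoch a q n = (\<Prod>i<n. 1 - a * q ^ i)"

(* Meaningful for norm q < 1, where the product converges; a vanishing factor makes it 0. *)
definition qpoch_inf :: "complex \<Rightarrow> complex \<Rightarrow> complex" where
  "qpoch_inf a q = prodinf (\<lambda>i. 1 - a * q ^ i)"

definition qpochs :: "complex list \<Rightarrow> complex \<Rightarrow> nat \<Rightarrow> complex" where
  "qpochs as q n = prod_list (map (\<lambda>a. qpoch a q n) as)"

definition qpochs_inf :: "complex list \<Rightarrow> complex \<Rightarrow> complex" where
  "qpochs_inf as q = prod_list (map (\<lambda>a. qpoch_inf a q) as)"

(* r = length as and s = length bs; the exponent 1 + s - r may be negative, hence powi. *)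
definition basic_hyp :: "complex list \<Rightarrow> complex list \<Rightarrow> complex \<Rightarrow> complex \<Rightarrow> complex" where
  "basic_hyp as bs q z =
     (\<Sum>n. qpochs as q n / qpochs (q # bs) q n
           * ((-1) ^ n * q ^ (n * (n - 1) div 2)) powi (1 + int (length bs) - int (length as))
           * z ^ n)"

(* Only meant for j \<le> n: natural-number subtraction truncates otherwise. *)
definition qbinom :: "complex \<Rightarrow> nat \<Rightarrow> nat \<Rightarrow> complex" where
  "qbinom q n j = qpoch q q n / (qpoch q q j * qpoch q q (n - j))"

definition rogers_szego :: "nat \<Rightarrow> complex \<Rightarrow> complex \<Rightarrow> complex \<Rightarrow> complex" where
  "rogers_szego n x y q = (\<Sum>j=0..n. qbinom q n j * x ^ j * y ^ (n - j))"

(* The parameter list x 1, y 1, x 2, y 2, ..., x k, y k. *)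
definition xy_params :: "nat \<Rightarrow> (nat \<Rightarrow> complex) \<Rightarrow> (nat \<Rightarrow> complex) \<Rightarrow> complex list" where
  "xy_params k x y = concat (map (\<lambda>i. [x i, y i]) [1..<Suc k])"

end

theory Submission
  imports Defs
begin

text \<open>
  For a single integer \<open>N\<close>, the \<open>q\<close>-binomial theorem (\<open>q_binomial\<close>) turns the ratio of shifted
  factorials into a power series in \<open>q ^ N\<close>:
  \[ \frac{(a;q)_N}{(c;q)_N}
     = \frac{(a;q)_\infty}{(c;q)_\infty} \frac{(c q^N;q)_\infty}{(a q^N;q)_\infty}
     = \frac{(a;q)_\infty}{(c;q)_\infty} \sum_m \frac{(c/a;q)_m}{(q;q)_m} a^m q^{mN}. \]
  With \<open>N = n\<^sub>1 + \<dots> + n\<^sub>k\<close> the factor \<open>q ^ (m * N)\<close> splits over the indices, and since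
  \<open>h\<^sub>n\<close> is homogeneous of degree \<open>n\<close> it is absorbed by replacing \<open>x\<^sub>i, y\<^sub>i\<close> by \<open>x\<^sub>i q ^ m, y\<^sub>i q ^ m\<close>.
  After exchanging the two summations, the multiple sum for fixed \<open>m\<close> is a product of \<open>k\<close> single sums,
  each given by the generating function (\<open>rogers_szego_generating_function\<close>)
  \[ \sum_n \frac{h_n(x,y|q)}{(q;q)_n} = \frac{1}{(x,y;q)_\infty}, \]
  which is two instances of the \<open>q\<close>-binomial theorem multiplied together. Finally
  \<open>1 / (x q ^ m; q)\<^sub>\<infinity> = (x; q)\<^sub>m / (x; q)\<^sub>\<infinity>\<close> leaves the basic hypergeometric series in \<open>m\<close>.
  The exchange is legitimate because the double series is dominated by a product of absolutely convergent
  series, the factors \<open>q ^ (m * N)\<close> having modulus at most 1.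
\<close>

section \<open>Shifted factorials\<close>

lemma qpoch_0 [simp]: "qpoch a q 0 = 1"
  by (simp add: qpoch_def)

lemma qpoch_Suc: "qpoch a q (Suc n) = qpoch a q n * (1 - a * q ^ n)"
  by (simp add: qpoch_def)

lemma qpoch_zero_left [simp]: "qpoch 0 q n = 1"
  by (simp add: qpoch_def)

lemma qpoch_add: "qpoch a q (n + m) = qpoch a q n * qpoch (a * q ^ n) q m"
  by (induction m) (simp_all add: qpoch_Suc power_add mult_ac)

lemma one_minus_mult_power_nonzero:
  fixes a q :: complex
  assumes "norm q < 1" "norm a < 1"
  shows "1 - a * q ^ n \<noteq> 0"
proof
  assume "1 - a * q ^ n = 0"
  then have "norm a * norm q ^ n = 1"
    by (metis eq_iff_diff_eq_0 norm_mult norm_one norm_power)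
  moreover have "norm a * norm q ^ n \<le> norm a * 1"
    using assms by (intro mult_left_mono power_le_one) auto
  ultimately show False using assms by simp
qed

lemma norm_mult_power_less_1:
  fixes z q :: complex
  assumes "norm q < 1" "norm z < 1"
  shows "norm (z * q ^ n) < 1"
proof -
  have "norm (z * q ^ n) \<le> norm z * 1"
    unfolding norm_mult norm_power using assms by (intro mult_left_mono power_le_one) auto
  with assms show ?thesis by simp
qed

lemma qpoch_nonzero:
  assumes "norm q < 1" "norm a < 1"
  shows "qpoch a q n \<noteq> 0"
  using one_minus_mult_power_nonzero[OF assms] by (simp add: qpoch_def)

lemma convergent_prod_qpoch:
  fixes a q :: complex
  assumes "norm q < 1"
  shows "convergent_prod (\<lambda>i. 1 - a * q ^ i)"
proof (rule abs_convergent_prod_imp_convergent_prod, rule summable_imp_abs_convergent_prod)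
  show "summable (\<lambda>i. norm (1 - a * q ^ i - 1))"
    using assms by (simp add: norm_mult norm_power)
qed

lemma qpoch_tendsto_qpoch_inf:
  assumes "norm q < 1"
  shows "(\<lambda>n. qpoch a q n) \<longlonglongrightarrow> qpoch_inf a q"
proof -
  have "(\<lambda>n. qpoch a q (Suc n)) \<longlonglongrightarrow> qpoch_inf a q"
    using convergent_prod_LIMSEQ[OF convergent_prod_qpoch[OF assms]]
    by (simp add: qpoch_def qpoch_inf_def lessThan_Suc_atMost)
  then show ?thesis by (simp add: filterlim_sequentially_Suc)
qed

lemma qpoch_inf_nonzero:
  assumes "norm q < 1" "norm a < 1"
  shows "qpoch_inf a q \<noteq> 0"
  unfolding qpoch_inf_def
  using convergent_prod_qpoch one_minus_mult_power_nonzero assms by (intro prodinf_nonzero) auto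

lemma qpoch_inf_split:
  assumes "norm q < 1"
  shows "qpoch_inf a q = qpoch a q n * qpoch_inf (a * q ^ n) q"
proof (rule LIMSEQ_unique)
  show "(\<lambda>m. qpoch a q (n + m)) \<longlonglongrightarrow> qpoch_inf a q"
    using LIMSEQ_ignore_initial_segment[OF qpoch_tendsto_qpoch_inf[OF assms], of a n]
    by (simp add: add.commute)
  show "(\<lambda>m. qpoch a q (n + m)) \<longlonglongrightarrow> qpoch a q n * qpoch_inf (a * q ^ n) q"
    unfolding qpoch_add by (intro tendsto_intros qpoch_tendsto_qpoch_inf assms)
qed

section \<open>The q-binomial theorem\<close>

text \<open>
  Numerator and denominator both converge, the latter to a nonzero limit. Boundedness of the
  coefficients is all that is needed for convergence in the open unit disc.
\<close>

lemma q_binomial_coeffs_bounded: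
  assumes "norm q < 1"
  shows "Bseq (\<lambda>n. qpoch a q n / qpoch q q n)"
proof -
  have "(\<lambda>n. qpoch a q n / qpoch q q n) \<longlonglongrightarrow> qpoch_inf a q / qpoch_inf q q"
    using assms by (intro tendsto_divide qpoch_tendsto_qpoch_inf qpoch_inf_nonzero)
  then show ?thesis by (intro convergent_imp_Bseq) (auto simp: convergent_def)
qed

lemma q_binomial_summable_norm:
  assumes "norm q < 1" "norm z < 1"
  shows "summable (\<lambda>n. norm (qpoch a q n / qpoch q q n * z ^ n))"
proof -
  obtain B where B: "norm (qpoch a q n / qpoch q q n) \<le> B" for n
    using q_binomial_coeffs_bounded[OF assms(1)] by (meson BseqE)
  show ?thesis
  proof (rule summable_comparison_test')
    show "summable (\<lambda>n. B * norm z ^ n)"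
      using assms by simp
    show "norm (norm (qpoch a q n / qpoch q q n * z ^ n)) \<le> B * norm z ^ n" for n
      using mult_right_mono[OF B[of n], of "norm z ^ n"]
      by (simp add: norm_mult norm_divide norm_power)
  qed
qed

text \<open>
  The coefficients satisfy \<open>t\<^sub>n\<^sub>+\<^sub>1 (1 - q ^ (n + 1)) = t\<^sub>n (1 - a q ^ n)\<close>, which for the sum \<open>F\<close> of the series
  says \<open>(1 - z) F z = (1 - a z) F (q z)\<close>. Iterating, \<open>F z\<close> is expressed by \<open>F (z q ^ n)\<close>, and
  continuity of \<open>F\<close> at 0 together with \<open>F 0 = 1\<close> gives the product.
\<close>

theorem q_binomial:
  assumes q: "norm q < 1" and z: "norm z < 1"
  shows "(\<lambda>n. qpoch a q n / qpoch q q n * z ^ n) sums (qpoch_inf (a * z) q / qpoch_inf z q)"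
proof -
  define t where "t n = qpoch a q n / qpoch q q n" for n
  define F where "F w = (\<Sum>n. t n * w ^ n)" for w
  have summable_t: "summable (\<lambda>n. t n * w ^ n)" if "norm w < 1" for w
    using summable_norm_cancel[OF q_binomial_summable_norm[OF q that]] by (simp add: t_def)
  have t_Suc: "t (Suc n) * (1 - q ^ Suc n) = t n * (1 - a * q ^ n)" for n
    using one_minus_mult_power_nonzero[OF q q, of n] by (simp add: t_def qpoch_Suc)
  have step: "(1 - w) * F w = (1 - a * w) * F (w * q)" if w: "norm w < 1" for w
  proof -
    have wq: "norm (w * q) < 1"
      using norm_mult_power_less_1[OF q w, of 1] by simp
    note sw = summable_t[OF w] and swq = summable_t[OF wq]
    have "F w - F (w * q) = (\<Sum>n. t n * (1 - q ^ n) * w ^ n)"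
      unfolding F_def suminf_diff[OF sw swq] by (simp add: algebra_simps power_mult_distrib)
    also have "\<dots> = (\<Sum>n. t (Suc n) * (1 - q ^ Suc n) * w ^ Suc n)"
    proof -
      have "summable (\<lambda>n. t n * (1 - q ^ n) * w ^ n)"
        using summable_diff[OF sw swq] by (simp add: algebra_simps power_mult_distrib)
      from suminf_split_head[OF this] show ?thesis by simp
    qed
    also have "\<dots> = (\<Sum>n. w * (t n * w ^ n) - a * w * (t n * (w * q) ^ n))"
      unfolding t_Suc by (simp add: algebra_simps power_mult_distrib)
    also have "\<dots> = w * F w - a * w * F (w * q)"
      unfolding F_def using sw swq
      by (subst suminf_diff[symmetric]) (auto intro: summable_mult simp: suminf_mult)
    finally show ?thesis by (simp add: algebra_simps)
  qed
  have iter: "qpoch z q n * F z = qpoch (a * z) q n * F (z * q ^ n)" for n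
  proof (induction n)
    case (Suc n)
    have "qpoch z q (Suc n) * F z = (1 - z * q ^ n) * (qpoch z q n * F z)"
      by (simp add: qpoch_Suc)
    also have "\<dots> = qpoch (a * z) q n * ((1 - z * q ^ n) * F (z * q ^ n))"
      unfolding Suc by (simp add: mult_ac)
    also have "\<dots> = qpoch (a * z) q (Suc n) * F (z * q ^ Suc n)"
      unfolding step[OF norm_mult_power_less_1[OF q z]] by (simp add: qpoch_Suc mult_ac)
    finally show ?case .
  qed simp
  have "F \<midarrow>0\<rightarrow> t 0"
    using summable_t by (intro powser_limit_0_strong[of 1]) (auto simp: F_def intro: summable_sums)
  moreover have "F 0 = t 0" by (simp add: F_def)
  ultimately have "isCont F 0" by (simp add: isCont_def)
  moreover have "(\<lambda>n. z * q ^ n) \<longlonglongrightarrow> 0"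
    using tendsto_mult_right_zero[OF LIMSEQ_power_zero[OF q]] .
  ultimately have "(\<lambda>n. F (z * q ^ n)) \<longlonglongrightarrow> F 0"
    by (rule isCont_tendsto_compose)
  then have "(\<lambda>n. qpoch (a * z) q n * F (z * q ^ n)) \<longlonglongrightarrow> qpoch_inf (a * z) q * F 0"
    by (intro tendsto_mult qpoch_tendsto_qpoch_inf q)
  moreover have "(\<lambda>n. qpoch (a * z) q n * F (z * q ^ n)) \<longlonglongrightarrow> qpoch_inf z q * F z"
    unfolding iter[symmetric] by (intro tendsto_intros qpoch_tendsto_qpoch_inf q)
  ultimately have "qpoch_inf z q * F z = qpoch_inf (a * z) q * F 0"
    by (rule LIMSEQ_unique[rotated])
  then have "F z = qpoch_inf (a * z) q / qpoch_inf z q"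
    using qpoch_inf_nonzero[OF q z] \<open>F 0 = t 0\<close> by (simp add: t_def field_simps)
  then show ?thesis
    using summable_sums[OF summable_t[OF z]] by (simp add: F_def t_def)
qed

text \<open>
  The form in which the \<open>q\<close>-binomial theorem enters: the dependence on \<open>N\<close> is now only through \<open>q ^ N\<close>.
\<close>

lemma qpoch_ratio_expansion:
  assumes q: "norm q < 1" and a: "norm a < 1" "a \<noteq> 0" and c: "norm c < 1"
  shows "(\<lambda>m. qpoch_inf a q / qpoch_inf c q * (qpoch (c / a) q m / qpoch q q m * a ^ m) * (q ^ m) ^ N)
           sums (qpoch a q N / qpoch c q N)"
proof -
  have "(\<lambda>m. qpoch_inf a q / qpoch_inf c q * (qpoch (c / a) q m / qpoch q q m * (a * q ^ N) ^ m))
          sums (qpoch_inf a q / qpoch_inf c q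
                 * (qpoch_inf (c / a * (a * q ^ N)) q / qpoch_inf (a * q ^ N) q))"
    by (intro sums_mult q_binomial q norm_mult_power_less_1 a)
  also have "qpoch_inf a q / qpoch_inf c q
      * (qpoch_inf (c / a * (a * q ^ N)) q / qpoch_inf (a * q ^ N) q) = qpoch a q N / qpoch c q N"
    using qpoch_inf_nonzero[OF q norm_mult_power_less_1[OF q a(1)], of N]
      qpoch_inf_nonzero[OF q norm_mult_power_less_1[OF q c], of N] a
      qpoch_inf_split[OF q, of a N] qpoch_inf_split[OF q, of c N]
    by simp
  finally show ?thesis
    by (simp add: power_mult_distrib mult_ac flip: power_mult)
qed

section \<open>The generating function of the Rogers-Szego polynomials\<close>

lemma rogers_szego_homogeneous:
  "rogers_szego n (x * s) (y * s) q = s ^ n * rogers_szego n x y q"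
  unfolding rogers_szego_def sum_distrib_left
proof (rule sum.cong)
  fix j assume "j \<in> {0..n}"
  then have "s ^ n = s ^ j * s ^ (n - j)"
    by (simp flip: power_add)
  then show "qbinom q n j * (x * s) ^ j * (y * s) ^ (n - j) = s ^ n * (qbinom q n j * x ^ j * y ^ (n - j))"
    by (simp add: power_mult_distrib mult_ac)
qed simp

lemma rogers_szego_convolution:
  assumes "norm q < 1"
  shows "rogers_szego n x y q / qpoch q q n
           = (\<Sum>j\<le>n. (x ^ j / qpoch q q j) * (y ^ (n - j) / qpoch q q (n - j)))"
  unfolding rogers_szego_def sum_divide_distrib atLeast0AtMost
  using qpoch_nonzero[OF assms assms] by (intro sum.cong) (auto simp: qbinom_def)

lemma euler_q_exponential:
  assumes "norm q < 1" "norm z < 1"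
  shows "(\<lambda>n. z ^ n / qpoch q q n) sums (1 / qpoch_inf z q)"
    and "summable (\<lambda>n. norm (z ^ n / qpoch q q n))"
  using q_binomial[OF assms, of 0] q_binomial_summable_norm[OF assms, of 0]
  by (simp_all add: qpoch_inf_def)

lemma rogers_szego_abs_summable:
  assumes "norm q < 1" "norm x < 1" "norm y < 1"
  shows "summable (\<lambda>n. norm (rogers_szego n x y q / qpoch q q n))"
proof (rule summable_comparison_test')
  show "summable (\<lambda>n. \<Sum>j\<le>n. norm (x ^ j / qpoch q q j) * norm (y ^ (n - j) / qpoch q q (n - j)))"
    using euler_q_exponential(2) assms by (intro summable_Cauchy_product) auto
  show "norm (norm (rogers_szego n x y q / qpoch q q n))
          \<le> (\<Sum>j\<le>n. norm (x ^ j / qpoch q q j) * norm (y ^ (n - j) / qpoch q q (n - j)))" for n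
    unfolding rogers_szego_convolution[OF assms(1)] real_norm_def abs_norm_cancel norm_mult[symmetric] by (rule norm_sum)
qed

text \<open>
  Divided by \<open>(q; q)\<^sub>n\<close>, the polynomial \<open>h\<^sub>n\<close> is the \<open>n\<close>-th term of the Cauchy product of the two Euler series
  for \<open>1 / (x; q)\<^sub>\<infinity>\<close> and \<open>1 / (y; q)\<^sub>\<infinity>\<close>.
\<close>

lemma rogers_szego_generating_function:
  assumes "norm q < 1" "norm x < 1" "norm y < 1"
  shows "(\<lambda>n. rogers_szego n x y q / qpoch q q n) sums (1 / (qpoch_inf x q * qpoch_inf y q))"
  using Cauchy_product_sums[OF euler_q_exponential(2)[OF assms(1,2)] euler_q_exponential(2)[OF assms(1,3)]]
    euler_q_exponential(1)[OF assms(1,2)] euler_q_exponential(1)[OF assms(1,3)]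
  by (simp add: rogers_szego_convolution[OF assms(1)] sums_iff)

text \<open>
  The weight \<open>(q ^ m) ^ n\<close> can be moved into the arguments of \<open>h\<^sub>n\<close> by homogeneity; the values
  at \<open>x q ^ m\<close> and \<open>y q ^ m\<close> of the infinite products differ from those at \<open>x\<close> and \<open>y\<close> by finite factors.
\<close>

lemma rogers_szego_generating_function_scaled:
  assumes q: "norm q < 1" and x: "norm x < 1" and y: "norm y < 1"
  shows "(\<lambda>n. (q ^ m) ^ n * (rogers_szego n x y q / qpoch q q n))
           sums (qpoch x q m * qpoch y q m / (qpoch_inf x q * qpoch_inf y q))"
proof -
  have "1 / (qpoch_inf (x * q ^ m) q * qpoch_inf (y * q ^ m) q)
          = qpoch x q m * qpoch y q m / (qpoch_inf x q * qpoch_inf y q)"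
    using qpoch_inf_split[OF q, of x m] qpoch_inf_split[OF q, of y m]
      qpoch_nonzero[OF q x, of m] qpoch_nonzero[OF q y, of m] by simp
  with rogers_szego_generating_function
        [OF q norm_mult_power_less_1[OF q x, of m] norm_mult_power_less_1[OF q y, of m]]
  show ?thesis by (simp add: rogers_szego_homogeneous)
qed

section \<open>Products of absolutely convergent series\<close>

lemma abs_summable_times:
  fixes f :: "'a \<Rightarrow> 'c :: {real_normed_field, banach}" and g :: "'b \<Rightarrow> 'c"
  assumes "(\<lambda>x. norm (f x)) summable_on A" "(\<lambda>y. norm (g y)) summable_on B"
  shows "(\<lambda>p. norm (case p of (x, y) \<Rightarrow> f x * g y)) summable_on A \<times> B"
  using assms unfolding Infinite_Sum.abs_summable_on_Sigma_iff
  by (auto simp: norm_mult abs_mult infsum_cmult_right' intro!: summable_on_cmult_right summable_on_cmult_left)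

lemma abs_summable_prod_PiE:
  fixes f :: "'i \<Rightarrow> 'a \<Rightarrow> 'c :: {real_normed_field, banach}"
  assumes "finite I" "\<And>i. i \<in> I \<Longrightarrow> (\<lambda>z. norm (f i z)) summable_on B i"
  shows "(\<lambda>n. norm (\<Prod>i\<in>I. f i (n i))) summable_on PiE I B"
  using assms
proof (induction I rule: finite_induct)
  case (insert i I)
  \<comment> \<open>A function on \<open>insert i I\<close> is a pair of its value at \<open>i\<close> and its restriction to \<open>I\<close>.\<close>
  let ?ext = "\<lambda>(y, g). g(i := y)"
  let ?F = "\<lambda>n. \<Prod>j\<in>insert i I. f j (n j)"
  have "(\<lambda>p. norm (case p of (y, g) \<Rightarrow> f i y * (\<Prod>j\<in>I. f j (g j)))) summable_on B i \<times> PiE I B"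
    using insert by (intro abs_summable_times) auto
  moreover have "?F (?ext p) = (case p of (y, g) \<Rightarrow> f i y * (\<Prod>j\<in>I. f j (g j)))" for p
  proof -
    have "(\<Prod>j\<in>I. f j (if j = i then fst p else snd p j)) = (\<Prod>j\<in>I. f j (snd p j))"
      using insert.hyps by (intro prod.cong) auto
    then show ?thesis
      using insert.hyps by (simp add: case_prod_unfold)
  qed
  ultimately have "(\<lambda>p. norm (?F (?ext p))) summable_on B i \<times> PiE I B"
    by simp
  moreover have "inj_on ?ext (B i \<times> PiE I B)"
    using inj_combinator[OF insert.hyps(2), of B] .
  ultimately show ?case
    unfolding PiE_insert_eq by (subst summable_on_reindex) (auto simp: o_def)
qed simp

lemma has_sum_prod_PiE:
  fixes f :: "'i \<Rightarrow> 'a \<Rightarrow> 'c :: {real_normed_field, banach}"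
  assumes "finite I" "\<And>i. i \<in> I \<Longrightarrow> (\<lambda>z. norm (f i z)) summable_on B i"
    "\<And>i. i \<in> I \<Longrightarrow> (f i has_sum S i) (B i)"
  shows "((\<lambda>n. \<Prod>i\<in>I. f i (n i)) has_sum (\<Prod>i\<in>I. S i)) (PiE I B)"
proof -
  have "(\<Sum>\<^sub>\<infinity>n\<in>PiE I B. \<Prod>i\<in>I. f i (n i)) = (\<Prod>i\<in>I. infsum (f i) (B i))"
    using assms by (intro infsum_prod_PiE_abs) auto
  also have "\<dots> = (\<Prod>i\<in>I. S i)"
    using assms(3) by (intro prod.cong infsumI) auto
  finally show ?thesis
    using has_sum_infsum[OF Infinite_Sum.abs_summable_summable[OF abs_summable_prod_PiE[where f = f, OF assms(1,2)]]] by simp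
qed

section \<open>The multiple sum\<close>

text \<open>
  The double series \<open>H\<close> over \<open>m\<close> and \<open>n\<close> gives the left-hand side when summed over \<open>m\<close> first and the
  right-hand side when summed over \<open>n\<close> first. It converges absolutely because dropping the
  factors \<open>(q ^ m) ^ n i\<close>, of modulus at most 1, leaves a function of \<open>m\<close> times a function of each \<open>n i\<close>.
\<close>

theorem rogers_szego_multiple_sum:
  fixes q a c :: complex and x y :: "'i \<Rightarrow> complex"
  assumes q: "norm q < 1" and I: "finite I"
    and a: "norm a < 1" "a \<noteq> 0" and c: "norm c < 1"
    and x: "\<And>i. i \<in> I \<Longrightarrow> norm (x i) < 1" and y: "\<And>i. i \<in> I \<Longrightarrow> norm (y i) < 1"
  shows "((\<lambda>n. qpoch a q (\<Sum>i\<in>I. n i) / qpoch c q (\<Sum>i\<in>I. n i)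
               * (\<Prod>i\<in>I. rogers_szego (n i) (x i) (y i) q / qpoch q q (n i)))
          has_sum
            qpoch_inf a q / (qpoch_inf c q * (\<Prod>i\<in>I. qpoch_inf (x i) q * qpoch_inf (y i) q))
              * (\<Sum>m. qpoch (c / a) q m * (\<Prod>i\<in>I. qpoch (x i) q m * qpoch (y i) q m)
                      / qpoch q q m * a ^ m))
         (I \<rightarrow>\<^sub>E (UNIV :: nat set))"
proof -
  define K where "K = qpoch_inf a q / qpoch_inf c q"
  define u where "u m = K * (qpoch (c / a) q m / qpoch q q m * a ^ m)" for m
  define g where "g i n = rogers_szego n (x i) (y i) q / qpoch q q n" for i n
  define P where "P = (\<Prod>i\<in>I. qpoch_inf (x i) q * qpoch_inf (y i) q)"
  define V where "V m = (\<Prod>i\<in>I. qpoch (x i) q m * qpoch (y i) q m)" for m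
  define H where "H = (\<lambda>(m, n). u m * (\<Prod>i\<in>I. (q ^ m) ^ n i * g i (n i)))"
  let ?A = "I \<rightarrow>\<^sub>E (UNIV :: nat set)"

  have u_summable: "summable (\<lambda>m. norm (u m))"
    unfolding u_def norm_mult[of K] by (intro summable_mult q_binomial_summable_norm q a)
  have u_abs: "(\<lambda>m. norm (u m)) summable_on UNIV"
    using u_summable by (intro norm_summable_imp_summable_on) simp
  have g_summable: "summable (\<lambda>n. norm (g i n))" if "i \<in> I" for i
    unfolding g_def using q x y that by (intro rogers_szego_abs_summable) auto
  have g_abs: "(\<lambda>n. norm (g i n)) summable_on UNIV" if "i \<in> I" for i
    using g_summable[OF that] by (intro norm_summable_imp_summable_on) simp
  have scaled_le: "norm ((q ^ m) ^ n * w) \<le> norm w" for m n :: nat and w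
    unfolding norm_mult norm_power using q
    by (intro mult_left_le_one_le zero_le_power power_le_one) auto

  have H_abs: "(\<lambda>p. norm (H p)) summable_on UNIV \<times> ?A"
  proof (rule Infinite_Sum.abs_summable_on_comparison_test)
    show "(\<lambda>p. norm (case p of (m, n) \<Rightarrow> u m * (\<Prod>i\<in>I. g i (n i)))) summable_on UNIV \<times> ?A"
      by (intro abs_summable_times abs_summable_prod_PiE u_abs I g_abs)
    show "norm (H p) \<le> norm (case p of (m, n) \<Rightarrow> u m * (\<Prod>i\<in>I. g i (n i)))" for p
      unfolding H_def case_prod_unfold norm_mult[of "u _"]
      by (intro mult_left_mono, unfold prod_norm[symmetric], intro prod_mono conjI scaled_le) auto
  qed
  then obtain S where S: "(H has_sum S) (UNIV \<times> ?A)"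
    using Infinite_Sum.abs_summable_summable summable_on_def by blast

  have sum_n: "((\<lambda>n. H (m, n)) has_sum u m * (V m / P)) ?A" for m
  proof -
    have "((\<lambda>n. \<Prod>i\<in>I. (q ^ m) ^ n i * g i (n i)) has_sum
            (\<Prod>i\<in>I. qpoch (x i) q m * qpoch (y i) q m / (qpoch_inf (x i) q * qpoch_inf (y i) q))) ?A"
    proof (rule has_sum_prod_PiE[OF I])
      fix i assume i: "i \<in> I"
      have s: "summable (\<lambda>n. norm ((q ^ m) ^ n * g i n))"
        by (rule summable_comparison_test'[OF g_summable[OF i]]) (simp only: real_norm_def abs_norm_cancel scaled_le)
      then show "(\<lambda>n. norm ((q ^ m) ^ n * g i n)) summable_on UNIV"
        by (intro norm_summable_imp_summable_on) simp
      show "((\<lambda>n. (q ^ m) ^ n * g i n) has_sum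
              qpoch (x i) q m * qpoch (y i) q m / (qpoch_inf (x i) q * qpoch_inf (y i) q)) UNIV"
        using rogers_szego_generating_function_scaled[OF q x[OF i] y[OF i], of m]
        by (intro norm_summable_imp_has_sum[OF s]) (simp add: g_def)
    qed
    then show ?thesis
      unfolding H_def V_def P_def prod_dividef[symmetric] prod.case by (rule has_sum_cmult_right)
  qed
  have "((\<lambda>m. u m * (V m / P)) has_sum S) UNIV"
    by (rule has_sum_SigmaD[OF S sum_n])
  then have "S = (\<Sum>m. u m * (V m / P))"
    using has_sum_imp_sums sums_unique by blast
  also have "\<dots> = K / P * (\<Sum>m. qpoch (c / a) q m * V m / qpoch q q m * a ^ m)"
  proof -
    have nz: "P \<noteq> 0" "K \<noteq> 0"
      using I qpoch_inf_nonzero[OF q] a c x y by (simp_all add: P_def K_def)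
    have "summable (\<lambda>m. u m * (V m / P))"
      using \<open>((\<lambda>m. u m * (V m / P)) has_sum S) UNIV\<close> has_sum_imp_sums sums_summable by blast
    then have "summable (\<lambda>m. P / K * (u m * (V m / P)))"
      by (rule summable_mult)
    then have "summable (\<lambda>m. qpoch (c / a) q m * V m / qpoch q q m * a ^ m)"
      using nz by (simp add: u_def mult_ac)
    then show ?thesis
      by (subst suminf_mult[symmetric]) (simp_all add: u_def mult_ac)
  qed
  finally have S_eq: "S = K / P * (\<Sum>m. qpoch (c / a) q m * V m / qpoch q q m * a ^ m)" .

  have sum_m: "((\<lambda>m. H (m, n)) has_sum
                 qpoch a q (\<Sum>i\<in>I. n i) / qpoch c q (\<Sum>i\<in>I. n i) * (\<Prod>i\<in>I. g i (n i))) UNIV" for n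
  proof -
    let ?N = "\<Sum>i\<in>I. n i"
    have s: "summable (\<lambda>m. norm (u m * (q ^ m) ^ ?N))"
      by (rule summable_comparison_test'[OF u_summable])
         (metis real_norm_def abs_norm_cancel mult.commute scaled_le)
    have "((\<lambda>m. u m * (q ^ m) ^ ?N) has_sum (qpoch a q ?N / qpoch c q ?N)) UNIV"
      using qpoch_ratio_expansion[OF q a c, of ?N]
      by (intro norm_summable_imp_has_sum[OF s]) (simp add: u_def K_def)
    then have "((\<lambda>m. u m * (q ^ m) ^ ?N * (\<Prod>i\<in>I. g i (n i))) has_sum
                 qpoch a q ?N / qpoch c q ?N * (\<Prod>i\<in>I. g i (n i))) UNIV"
      by (rule has_sum_cmult_left)
    then show ?thesis
      by (simp add: H_def prod.distrib power_sum mult.assoc)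
  qed
  have "((\<lambda>(n, m). H (m, n)) has_sum S) (?A \<times> UNIV)"
    using S by (subst (asm) has_sum_swap) simp
  then have "((\<lambda>n. qpoch a q (\<Sum>i\<in>I. n i) / qpoch c q (\<Sum>i\<in>I. n i) * (\<Prod>i\<in>I. g i (n i))) has_sum S) ?A"
    by (rule has_sum_SigmaD) (use sum_m in simp)
  then show ?thesis
    unfolding S_eq by (simp add: g_def K_def P_def V_def)
qed

section \<open>The parameter lists\<close>

lemma prod_list_xy_params:
  "prod_list (map f (xy_params k x y)) = (\<Prod>i=1..k. f (x i) * f (y i))"
  by (induction k) (simp_all add: xy_params_def mult_ac)

lemma length_xy_params: "length (xy_params k x y) = 2 * k"
  by (induction k) (simp_all add: xy_params_def)

text \<open>
  With \<open>2k + 1\<close> upper and \<open>2k\<close> lower parameters the exponent of \<open>(-1) ^ n q ^ (n (n - 1) / 2)\<close> is zero, and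
  the zero lower parameters contribute only factors 1.
\<close>

lemma basic_hyp_xy_params:
  "basic_hyp (b # xy_params k x y) (replicate (2 * k) 0) q z
     = (\<Sum>m. qpoch b q m * (\<Prod>i=1..k. qpoch (x i) q m * qpoch (y i) q m) / qpoch q q m * z ^ m)"
proof -
  have "qpochs (q # replicate (2 * k) 0) q m = qpoch q q m" for m
    by (simp add: qpochs_def prod_list_replicate)
  moreover have "qpochs (b # xy_params k x y) q m
      = qpoch b q m * (\<Prod>i=1..k. qpoch (x i) q m * qpoch (y i) q m)" for m
    by (simp add: qpochs_def prod_list_xy_params)
  ultimately show ?thesis
    by (simp add: basic_hyp_def length_xy_params)
qed

theorem theorem12p1:
  fixes q :: real and k :: nat and a c :: complex and x y :: "nat \<Rightarrow> complex"
  defines "Q \<equiv> complex_of_real q"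
  assumes "0 < q" and "q < 1" and "k \<ge> 1" and "a \<noteq> 0"
    and "norm a < 1" and "norm c < 1"
    and "\<And>i. i \<in> {1..k} \<Longrightarrow> norm (x i) < 1"
    and "\<And>i. i \<in> {1..k} \<Longrightarrow> norm (y i) < 1"
  shows "((\<lambda>n. qpoch a Q (\<Sum>i=1..k. n i) * (\<Prod>i=1..k. rogers_szego (n i) (x i) (y i) Q)
               / (qpoch c Q (\<Sum>i=1..k. n i) * (\<Prod>i=1..k. qpoch Q Q (n i))))
          has_sum
            qpoch_inf a Q / qpochs_inf (c # xy_params k x y) Q
              * basic_hyp ((c / a) # xy_params k x y) (replicate (2 * k) 0) Q a)
         ({1..k} \<rightarrow>\<^sub>E (UNIV :: nat set))"
proof -
  have Q: "norm Q < 1"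
    using assms by (simp add: Q_def)
  have pochs: "qpochs_inf (c # xy_params k x y) Q
      = qpoch_inf c Q * (\<Prod>i=1..k. qpoch_inf (x i) Q * qpoch_inf (y i) Q)"
    by (simp add: qpochs_inf_def prod_list_xy_params)
  show ?thesis
    using rogers_szego_multiple_sum[OF Q, of "{1..k}" a c x y] assms
    unfolding basic_hyp_xy_params pochs by (simp add: prod_dividef)
qed

end
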